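(* Let $\Omega\subset\mathbb{O}$ be a domain. Then the map $P:\mathcal{D}_\Omega\to\mathbb{C}$, $P([(z,I)]_\Omega)=z$, is holomorphic with respect to the complex structure $\Pi_\Omega$, and $(\mathcal{D}_\Omega,P)$ is a Riemann domain over $\mathbb{C}$.
   Context: $\mathbb{O}$ is the algebra of octonions, identified with $\mathbb{R}^8$ with the Euclidean topology; a domain is a nonempty connected open set. $\mathbb{S}$ is the sphere of octonions with zero real part and unit norm. For $I\in\mathbb{S}$ and $z=\alpha+\beta i\in\mathbb{C}$, $z_I=\tau_I(z)=\alpha+\beta I$. For a domain $\Omega\subset\mathbb{O}$, $\Omega^I=\{z\in\mathbb{C}:z_I\in\Omega\}$. CCL equivalence on $\Omega$. A path in a space $X$ is a continuous map $[0,1]\to X$. For paths $\gamma$ in $\mathbb{C}$ and $\Theta$ in $\mathbb{S}$, the circular lifting of $\gamma$ via $\Theta$ is the path $\gamma_\Theta(t)=\tau_{\Theta(t)}(\gamma(t))$ in $\mathbb{O}$; $\gamma$ is its base and $\Theta$ its spherical coordinate. Two circular liftings $\gamma_{\Theta_1},\gamma_{\Theta_2}$ are coupled if they have a common base $\gamma$ and $\Theta_1(0)=\Theta_2(0)$. Points $x_1,x_2\in\Omega$ are CCL-connected, $x_1\overset{\Omega}{\sim}x_2$, if there are coupled circular liftings $\gamma_{\Theta_1},\gamma_{\Theta_2}$ with $\gamma_{\Theta_k}([0,1])\subset\Omega$ and $\gamma_{\Theta_k}(1)=x_k$ ($k=1,2$). Points $x,x'\in\Omega$ are CCL-equivalent,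 $x\overset{\Omega}{\simeq}x'$, if there is a finite sequence $x=x_0,x_1,\dots,x_n=x'$ in $\Omega$ with $x_{k-1}\overset{\Omega}{\sim}x_k$ for $k=1,\dots,n$. The quotient. $\hat\Omega=\bigcup_{I\in\mathbb{S}}\Omega^I\times\{I\}=\{(z,I)\in\mathbb{C}\times\mathbb{S}:z_I\in\Omega\}$ with the disjoint-union topology (a set is open iff it is of the form $\bigcup_{I}O^I\times\{I\}$ with each $O^I$ open in $\Omega^I$). On $\hat\Omega$: $(z,I)\overset{\hat\Omega}{\simeq}(z',I')$ iff $z=z'$ and $z_I\overset{\Omega}{\simeq}z'_{I'}$. $\mathcal{D}_\Omega$ is the quotient space of $\hat\Omega$ by this equivalence relation with the quotient topology, $[(z,I)]_\Omega$ the class of $(z,I)$, $\pi:\hat\Omega\to\mathcal{D}_\Omega$ the canonical projection, and $\pi^I:\Omega^I\to\mathcal{D}_\Omega$, $\pi^I(z)=[(z,I)]_\Omega$ (an injective map). $\Pi_\Omega$ is the complex structure on $\mathcal{D}_\Omega$ generated by the complex atlas $\{(\pi^I)^{-1}:\pi^I(\Omega^I)\to\Omega^I\}_{I\in\mathbb{S}}$. A Riemann domain over $\mathbb{C}$ is a topological space equipped with a local homeomorphism from it to $\mathbb{C}$. *)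

theory Defs
  imports "HOL-Analysis.Analysis"
begin

section \<open>Octonions\<close>

text \<open>
  The octonions are obtained from the complex numbers by two Cayley-Dickson doublings,
  (a, b) (c, d) = (a c - d* b, d a + b c*). The product type carries the Euclidean inner
  product, norm and topology of the eight-dimensional real space.
\<close>

type_synonym quaternion = "complex \<times> complex"
type_synonym octonion = "quaternion \<times> quaternion"

definition quat_cnj :: "quaternion \<Rightarrow> quaternion" where
  "quat_cnj p = (cnj (fst p), - snd p)"

definition quat_mult :: "quaternion \<Rightarrow> quaternion \<Rightarrow> quaternion" where
  "quat_mult p q =
     (fst p * fst q - cnj (snd q) * snd p, snd q * fst p + snd p * cnj (fst q))"

definition oct_mult :: "octonion \<Rightarrow> octonion \<Rightarrow> octonion" where
  "oct_mult x y =
     (quat_mult (fst x) (fst y) - quat_mult (quat_cnj (snd y)) (snd x),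
      quat_mult (snd y) (fst x) + quat_mult (snd x) (quat_cnj (fst y)))"

definition oct_one :: octonion where
  "oct_one = ((1, 0), (0, 0))"

definition oct_Re :: "octonion \<Rightarrow> real" where
  "oct_Re x = Re (fst (fst x))"

definition oct_sphere :: "octonion set" where
  "oct_sphere = {x. oct_Re x = 0 \<and> norm x = 1}"

definition tau :: "octonion \<Rightarrow> complex \<Rightarrow> octonion" where
  "tau I z = Re z *\<^sub>R oct_one + Im z *\<^sub>R I"

definition slice :: "octonion set \<Rightarrow> octonion \<Rightarrow> complex set" where
  "slice \<Omega> I = {z. tau I z \<in> \<Omega>}"

lemma DIM_octonion: "DIM(octonion) = 8"
  by simp

lemma oct_mult_one: "oct_mult oct_one x = x" "oct_mult x oct_one = x"
  by (simp_all add: oct_mult_def quat_mult_def quat_cnj_def oct_one_def prod_eq_iff)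

lemma norm_oct_squared:
  "(norm (x :: octonion))\<^sup>2 =
     (Re (fst (fst x)))\<^sup>2 + (Im (fst (fst x)))\<^sup>2 + (Re (snd (fst x)))\<^sup>2 + (Im (snd (fst x)))\<^sup>2 +
     (Re (fst (snd x)))\<^sup>2 + (Im (fst (snd x)))\<^sup>2 + (Re (snd (snd x)))\<^sup>2 + (Im (snd (snd x)))\<^sup>2"
  by (simp add: norm_prod_def cmod_def)

lemma norm_oct_mult: "norm (oct_mult x y) = norm x * norm y"
proof -
  have "(norm (oct_mult x y))\<^sup>2 = (norm x)\<^sup>2 * (norm y)\<^sup>2"
    unfolding norm_oct_squared
    by (simp add: oct_mult_def quat_mult_def quat_cnj_def) algebra
  then have "(norm (oct_mult x y))\<^sup>2 = (norm x * norm y)\<^sup>2"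
    by (simp add: power_mult_distrib)
  then show ?thesis
    by (simp add: power2_eq_iff_nonneg)
qed

lemma oct_sphere_square:
  assumes "I \<in> oct_sphere"
  shows "oct_mult I I = - oct_one"
proof -
  have 0: "Re (fst (fst I)) = 0" and "(norm I)\<^sup>2 = 1"
    using assms by (auto simp: oct_sphere_def oct_Re_def)
  then have "(Im (fst (fst I)))\<^sup>2 + (Re (snd (fst I)))\<^sup>2 + (Im (snd (fst I)))\<^sup>2 +
     (Re (fst (snd I)))\<^sup>2 + (Im (fst (snd I)))\<^sup>2 + (Re (snd (snd I)))\<^sup>2 + (Im (snd (snd I)))\<^sup>2 = 1"
    unfolding norm_oct_squared by simp
  with 0 show ?thesis
    by (simp add: oct_mult_def quat_mult_def quat_cnj_def oct_one_def prod_eq_iff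
        complex_eq_iff power2_eq_square)
qed


section \<open>CCL equivalence\<close>

definition path_in_sphere :: "(real \<Rightarrow> octonion) \<Rightarrow> bool" where
  "path_in_sphere \<Theta> \<longleftrightarrow> path \<Theta> \<and> path_image \<Theta> \<subseteq> oct_sphere"

definition circular_lift :: "(real \<Rightarrow> complex) \<Rightarrow> (real \<Rightarrow> octonion) \<Rightarrow> real \<Rightarrow> octonion" where
  "circular_lift \<gamma> \<Theta> t = tau (\<Theta> t) (\<gamma> t)"

definition ccl_connected :: "octonion set \<Rightarrow> octonion \<Rightarrow> octonion \<Rightarrow> bool" where
  "ccl_connected \<Omega> x1 x2 \<longleftrightarrow>
     x1 \<in> \<Omega> \<and> x2 \<in> \<Omega> \<and>
     (\<exists>\<gamma> \<Theta>1 \<Theta>2. path \<gamma> \<and> path_in_sphere \<Theta>1 \<and> path_in_sphere \<Theta>2 \<and> \<Theta>1 0 = \<Theta>2 0 \<and>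
        circular_lift \<gamma> \<Theta>1 ` {0..1} \<subseteq> \<Omega> \<and> circular_lift \<gamma> \<Theta>2 ` {0..1} \<subseteq> \<Omega> \<and>
        circular_lift \<gamma> \<Theta>1 1 = x1 \<and> circular_lift \<gamma> \<Theta>2 1 = x2)"

definition ccl_equiv :: "octonion set \<Rightarrow> octonion \<Rightarrow> octonion \<Rightarrow> bool" where
  "ccl_equiv \<Omega> x y \<longleftrightarrow> x \<in> \<Omega> \<and> y \<in> \<Omega> \<and> (ccl_connected \<Omega>)\<^sup>*\<^sup>* x y"


section \<open>The quotient space\<close>

text \<open>
  In keeping with the library's disjoint sum, which puts the index first, a point (z, I) of the
  disjoint union is represented by the pair (I, z).
\<close>

definition hat_space :: "octonion set \<Rightarrow> (octonion \<times> complex) topology" where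
  "hat_space \<Omega> = sum_topology (\<lambda>I. top_of_set (slice \<Omega> I)) oct_sphere"

definition hat_rel :: "octonion set \<Rightarrow> ((octonion \<times> complex) \<times> (octonion \<times> complex)) set" where
  "hat_rel \<Omega> = {((I, z), (I', z')).
     (I, z) \<in> topspace (hat_space \<Omega>) \<and> (I', z') \<in> topspace (hat_space \<Omega>) \<and>
     z = z' \<and> ccl_equiv \<Omega> (tau I z) (tau I' z')}"

definition quotient_topology :: "'a topology \<Rightarrow> ('a \<times> 'a) set \<Rightarrow> 'a set topology" where
  "quotient_topology X r =
     topology (\<lambda>V. V \<subseteq> topspace X // r \<and> openin X {x \<in> topspace X. r `` {x} \<in> V})"

definition D_space :: "octonion set \<Rightarrow> (octonion \<times> complex) set topology" where
  "D_space \<Omega> = quotient_topology (hat_space \<Omega>) (hat_rel \<Omega>)"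

definition pi_slice :: "octonion set \<Rightarrow> octonion \<Rightarrow> complex \<Rightarrow> (octonion \<times> complex) set" where
  "pi_slice \<Omega> I z = hat_rel \<Omega> `` {(I, z)}"

definition P_map :: "octonion set \<Rightarrow> (octonion \<times> complex) set \<Rightarrow> complex" where
  "P_map \<Omega> c = (THE z. \<exists>I\<in>oct_sphere. z \<in> slice \<Omega> I \<and> c = pi_slice \<Omega> I z)"

lemma istopology_quotient:
  "istopology (\<lambda>V. V \<subseteq> topspace X // r \<and> openin X {x \<in> topspace X. r `` {x} \<in> V})"
proof -
  have 1: "{x \<in> topspace X. r `` {x} \<in> S \<inter> T} =
      {x \<in> topspace X. r `` {x} \<in> S} \<inter> {x \<in> topspace X. r `` {x} \<in> T}" for S T
    by auto
  have 2: "{x \<in> topspace X. r `` {x} \<in> \<Union>\<K>} =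
      (\<Union>K\<in>\<K>. {x \<in> topspace X. r `` {x} \<in> K})" for \<K>
    by auto
  show ?thesis
    unfolding istopology_def 1 2 by blast
qed

lemma openin_quotient_topology:
  "openin (quotient_topology X r) V \<longleftrightarrow>
     V \<subseteq> topspace X // r \<and> openin X {x \<in> topspace X. r `` {x} \<in> V}"
  by (simp add: quotient_topology_def istopology_quotient)

lemma topspace_quotient_topology [simp]:
  "topspace (quotient_topology X r) = topspace X // r"
proof -
  have "{x \<in> topspace X. r `` {x} \<in> topspace X // r} = topspace X"
    by (auto simp: quotient_def)
  then have "openin (quotient_topology X r) (topspace X // r)"
    by (simp add: openin_quotient_topology)
  then show ?thesis
    by (meson openin_quotient_topology openin_subset openin_topspace subset_antisym)
qed

lemma quotient_map_quotient_topology: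
  "quotient_map X (quotient_topology X r) (\<lambda>x. r `` {x})"
  by (auto simp: quotient_map_def openin_quotient_topology quotient_def)

lemma topspace_hat_space:
  "topspace (hat_space \<Omega>) = {(I, z). I \<in> oct_sphere \<and> tau I z \<in> \<Omega>}"
  by (auto simp: hat_space_def slice_def)

lemma ccl_equiv_sym: "ccl_equiv \<Omega> x y \<Longrightarrow> ccl_equiv \<Omega> y x"
proof -
  have "symp (ccl_connected \<Omega>)"
    unfolding ccl_connected_def by (rule sympI) metis
  then have "symp (ccl_connected \<Omega>)\<^sup>*\<^sup>*"
    by (rule symp_rtranclp)
  then show "ccl_equiv \<Omega> x y \<Longrightarrow> ccl_equiv \<Omega> y x"
    by (auto simp: ccl_equiv_def dest: sympD)
qed

lemma equiv_hat_rel: "equiv (topspace (hat_space \<Omega>)) (hat_rel \<Omega>)"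
proof (rule equivI)
  show "hat_rel \<Omega> \<subseteq> topspace (hat_space \<Omega>) \<times> topspace (hat_space \<Omega>)"
    by (auto simp: hat_rel_def)
  show "refl_on (topspace (hat_space \<Omega>)) (hat_rel \<Omega>)"
    by (auto simp: refl_on_def hat_rel_def ccl_equiv_def topspace_hat_space)
  show "sym (hat_rel \<Omega>)"
    by (auto simp: sym_def hat_rel_def intro: ccl_equiv_sym)
  show "trans (hat_rel \<Omega>)"
    by (auto simp: trans_def hat_rel_def ccl_equiv_def intro: rtranclp_trans)
qed

lemma pi_slice_eq_iff:
  assumes "I \<in> oct_sphere" "z \<in> slice \<Omega> I" "J \<in> oct_sphere" "w \<in> slice \<Omega> J"
  shows "pi_slice \<Omega> I z = pi_slice \<Omega> J w \<longleftrightarrow> z = w \<and> ccl_equiv \<Omega> (tau I z) (tau J w)"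
proof -
  have "(I, z) \<in> topspace (hat_space \<Omega>)" "(J, w) \<in> topspace (hat_space \<Omega>)"
    using assms by (auto simp: topspace_hat_space slice_def)
  then show ?thesis
    unfolding pi_slice_def by (subst eq_equiv_class_iff[OF equiv_hat_rel]) (auto simp: hat_rel_def)
qed

lemma inj_on_pi_slice: "I \<in> oct_sphere \<Longrightarrow> inj_on (pi_slice \<Omega> I) (slice \<Omega> I)"
  by (simp add: inj_on_def pi_slice_eq_iff)

lemma P_map_pi_slice:
  assumes "I \<in> oct_sphere" "z \<in> slice \<Omega> I"
  shows "P_map \<Omega> (pi_slice \<Omega> I z) = z"
  unfolding P_map_def by (rule the_equality) (use assms in \<open>auto simp: pi_slice_eq_iff\<close>)


section \<open>Complex structures and Riemann domains\<close>

text \<open>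
  A chart is a pair of its domain U and a map whose values outside U are irrelevant.
\<close>

definition complex_chart :: "'a topology \<Rightarrow> 'a set \<times> ('a \<Rightarrow> complex) \<Rightarrow> bool" where
  "complex_chart X = (\<lambda>(U, \<phi>).
     openin X U \<and> open (\<phi> ` U) \<and>
     homeomorphic_map (subtopology X U) (top_of_set (\<phi> ` U)) \<phi>)"

definition compatible_charts ::
    "'a set \<times> ('a \<Rightarrow> complex) \<Rightarrow> 'a set \<times> ('a \<Rightarrow> complex) \<Rightarrow> bool" where
  "compatible_charts = (\<lambda>(U, \<phi>) (V, \<psi>).
     (\<psi> \<circ> inv_into U \<phi>) holomorphic_on \<phi> ` (U \<inter> V) \<and>
     (\<phi> \<circ> inv_into V \<psi>) holomorphic_on \<psi> ` (U \<inter> V))"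

text \<open>
  The complex structure generated by an atlas is the maximal atlas containing it.
\<close>

definition generated_complex_structure ::
    "'a topology \<Rightarrow> ('a set \<times> ('a \<Rightarrow> complex)) set \<Rightarrow> ('a set \<times> ('a \<Rightarrow> complex)) set" where
  "generated_complex_structure X A =
     {c. complex_chart X c \<and> (\<forall>a\<in>A. compatible_charts a c)}"

definition holomorphic_wrt ::
    "('a set \<times> ('a \<Rightarrow> complex)) set \<Rightarrow> ('a \<Rightarrow> complex) \<Rightarrow> bool" where
  "holomorphic_wrt S f \<longleftrightarrow> (\<forall>(U, \<phi>)\<in>S. (f \<circ> inv_into U \<phi>) holomorphic_on \<phi> ` U)"

definition slice_atlas ::
    "octonion set \<Rightarrow> ((octonion \<times> complex) set set \<times> ((octonion \<times> complex) set \<Rightarrow> complex)) set" where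
  "slice_atlas \<Omega> =
     (\<lambda>I. (pi_slice \<Omega> I ` slice \<Omega> I, inv_into (slice \<Omega> I) (pi_slice \<Omega> I))) ` oct_sphere"

definition Pi_structure ::
    "octonion set \<Rightarrow> ((octonion \<times> complex) set set \<times> ((octonion \<times> complex) set \<Rightarrow> complex)) set" where
  "Pi_structure \<Omega> = generated_complex_structure (D_space \<Omega>) (slice_atlas \<Omega>)"

definition local_homeomorphism ::
    "'a topology \<Rightarrow> 'b topology \<Rightarrow> ('a \<Rightarrow> 'b) \<Rightarrow> bool" where
  "local_homeomorphism X Y f \<longleftrightarrow>
     (\<forall>x\<in>topspace X. \<exists>U. x \<in> U \<and> openin X U \<and> openin Y (f ` U) \<and>
        homeomorphic_map (subtopology X U) (subtopology Y (f ` U)) f)"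

definition riemann_domain :: "'a topology \<Rightarrow> ('a \<Rightarrow> complex) \<Rightarrow> bool" where
  "riemann_domain X f \<longleftrightarrow> local_homeomorphism X euclidean f"

end

theory Submission
  imports Defs
begin

text \<open>
  The slice projections are continuous and injective, so everything rests on their being open,
  that is, on the following stability property: if \<open>tau I z\<close> and \<open>tau J z\<close> are CCL-equivalent, then
  so are \<open>tau I w\<close> and \<open>tau J w\<close> for all \<open>w\<close> near \<open>z\<close>. For one CCL step with \<open>z\<close> not real, the two
  coupled liftings end (up to a joint conjugation) at base point \<open>z\<close> with spherical coordinates
  \<open>I\<close> and \<open>J\<close>, and one appends the segment from \<open>z\<close> to \<open>w\<close> to the base, keeping \<open>I\<close> and \<open>J\<close> fixed. For
  real \<open>z\<close>, all the points \<open>tau K w\<close> with \<open>w\<close> near \<open>z\<close> lie in a ball around the single point \<open>tau I z\<close>,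
  and a path in the sphere from \<open>I\<close> to \<open>J\<close> over the segment does the job. Hence the inverse
  projections are charts, on whose domains \<open>P\<close> is the chart map itself.
\<close>

section \<open>Slices\<close>

text \<open>The imaginary octonions form a Euclidean space of dimension 7, so
  \<open>oct_sphere\<close> is the isometric image of a unit sphere of dimension 6. This supplies
  the paths between spherical coordinates needed at real points.\<close>

lemma path_connected_oct_sphere: "path_connected oct_sphere"
proof -
  define f :: "real \<times> complex \<times> complex \<times> complex \<Rightarrow> octonion"
    where "f = (\<lambda>(a, b, c, d). ((\<i> * of_real a, b), (c, d)))"
  have "path_connected (f ` sphere 0 1)"
    unfolding f_def case_prod_beta
    by (intro path_connected_continuous_image path_connected_sphere continuous_intros) simp
  moreover have norm_f: "norm (f p) = norm p" for p
    by (cases p) (simp add: f_def norm_prod_def norm_mult)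
  have "x \<in> f ` sphere 0 1" if "x \<in> oct_sphere" for x
  proof -
    obtain u b c d where x: "x = ((u, b), (c, d))"
      by (metis surj_pair)
    have "x = f (Im u, b, c, d)"
      using that by (simp add: x f_def oct_sphere_def oct_Re_def complex_eq_iff)
    moreover have "norm x = 1"
      using that by (simp add: oct_sphere_def)
    ultimately show ?thesis
      using norm_f by (metis imageI mem_sphere_0)
  qed
  moreover have "f ` sphere 0 1 \<subseteq> oct_sphere"
    using norm_f by (auto simp: oct_sphere_def oct_Re_def f_def)
  ultimately show ?thesis
    by (metis subsetI subset_antisym)
qed

lemma uminus_oct_sphere: "I \<in> oct_sphere \<Longrightarrow> - I \<in> oct_sphere"
  by (auto simp: oct_sphere_def oct_Re_def)

lemma tau_cnj: "tau I (cnj z) = tau (- I) z"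
  by (simp add: tau_def)

lemma oct_Re_tau: "I \<in> oct_sphere \<Longrightarrow> oct_Re (tau I z) = Re z"
  by (simp add: tau_def oct_sphere_def oct_Re_def oct_one_def)

text \<open>Pythagoras: \<open>I\<close> is a unit vector orthogonal to
  \<open>oct_one\<close>.\<close>

lemma norm_tau:
  assumes "I \<in> oct_sphere"
  shows "norm (tau I z) = norm z"
proof -
  have 0: "Re (fst (fst I)) = 0" and "(norm I)\<^sup>2 = 1"
    using assms by (auto simp: oct_sphere_def oct_Re_def)
  then have *: "(Im (fst (fst I)))\<^sup>2 + (Re (snd (fst I)))\<^sup>2 + (Im (snd (fst I)))\<^sup>2 +
     (Re (fst (snd I)))\<^sup>2 + (Im (fst (snd I)))\<^sup>2 + (Re (snd (snd I)))\<^sup>2 + (Im (snd (snd I)))\<^sup>2 = 1"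
    unfolding norm_oct_squared by simp
  \<comment> \<open>The factor 1 is kept so that \<open>*\<close>, read backwards, expands it into
    the squared coordinates of \<open>I\<close>.\<close>
  have "(norm (tau I z))\<^sup>2 = (Re z)\<^sup>2 + (Im z)\<^sup>2 * 1"
    unfolding norm_oct_squared *[symmetric]
    by (simp add: 0 tau_def oct_one_def power_mult_distrib algebra_simps)
  also have "\<dots> = (norm z)\<^sup>2"
    by (simp add: cmod_def)
  finally show ?thesis
    by (simp add: power2_eq_iff_nonneg)
qed

lemma dist_tau:
  assumes "I \<in> oct_sphere"
  shows "dist (tau I z) (tau I w) = dist z w"
proof -
  have "tau I z - tau I w = tau I (z - w)"
    by (simp add: tau_def algebra_simps)
  then show ?thesis
    using norm_tau[OF assms] by (simp add: dist_norm)
qed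

text \<open>Real parts agree, and norms determine the imaginary parts up to sign. Off the real axis
  a point thus has exactly two representations, exchanged by joint conjugation; on it the spherical
  coordinate is arbitrary.\<close>

lemma tau_eq_cases:
  assumes "I \<in> oct_sphere" "J \<in> oct_sphere" "tau I z = tau J w"
  obtains "Im z = 0" "w = z" | "w = z" "J = I" | "w = cnj z" "J = - I"
proof -
  have Re: "Re z = Re w"
    using assms oct_Re_tau by metis
  have eq: "Im z *\<^sub>R I = Im w *\<^sub>R J"
    using assms(3) Re by (simp add: tau_def)
  have "norm I = 1" "norm J = 1"
    using assms by (auto simp: oct_sphere_def)
  then have "\<bar>Im z\<bar> = \<bar>Im w\<bar>"
    using arg_cong[OF eq, of norm] by simp
  then consider "Im z = 0" "Im w = 0" | "Im z \<noteq> 0" "Im w = Im z" | "Im z \<noteq> 0" "Im w = - Im z"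
    by linarith
  then show thesis
  proof cases
    case 1
    then show thesis using that(1) Re by (simp add: complex_eq_iff)
  next
    case 2
    then have "J = I"
      using eq by (metis scaleR_cancel_left)
    then show thesis using that(2) Re 2 by (simp add: complex_eq_iff)
  next
    case 3
    then have "Im z *\<^sub>R I = Im z *\<^sub>R (- J)"
      using eq by simp
    then have "J = - I"
      using 3(1) by (metis scaleR_cancel_left minus_minus)
    then show thesis using that(3) Re 3 by (simp add: complex_eq_iff)
  qed
qed

lemma tau_eq_real: "Im z = 0 \<Longrightarrow> tau I z = tau J z"
  by (simp add: tau_def)

lemma open_slice:
  assumes "open \<Omega>"
  shows "open (slice \<Omega> I)"
proof -
  have "open (tau I -` \<Omega>)"
    unfolding tau_def by (intro open_vimage assms continuous_intros)
  then show ?thesis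
    by (simp add: slice_def vimage_def)
qed


section \<open>Stability of CCL equivalence\<close>

text \<open>Normal form of a CCL step: the definition prescribes only where the liftings end,
  whereas appending a segment at \<open>z\<close> needs the base itself to end at
  \<open>z\<close>.\<close>

lemma ccl_connectedE:
  assumes "ccl_connected \<Omega> x1 x2" "x1 = tau I z" "I \<in> oct_sphere"
  obtains \<gamma> \<Theta>1 \<Theta>2 where "path \<gamma>" "path_in_sphere \<Theta>1" "path_in_sphere \<Theta>2" "\<Theta>1 0 = \<Theta>2 0"
    "circular_lift \<gamma> \<Theta>1 ` {0..1} \<subseteq> \<Omega>" "circular_lift \<gamma> \<Theta>2 ` {0..1} \<subseteq> \<Omega>"
    "\<gamma> 1 = z" "x2 = tau (\<Theta>2 1) z" "Im z = 0 \<or> \<Theta>1 1 = I"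
proof -
  obtain \<gamma> \<Theta>1 \<Theta>2 where *: "path \<gamma>" "path_in_sphere \<Theta>1" "path_in_sphere \<Theta>2" "\<Theta>1 0 = \<Theta>2 0"
    and sub: "circular_lift \<gamma> \<Theta>1 ` {0..1} \<subseteq> \<Omega>" "circular_lift \<gamma> \<Theta>2 ` {0..1} \<subseteq> \<Omega>"
    and e: "circular_lift \<gamma> \<Theta>1 1 = x1" "circular_lift \<gamma> \<Theta>2 1 = x2"
    using assms(1) unfolding ccl_connected_def by blast
  have "\<Theta>1 1 \<in> oct_sphere"
    using *(2) by (auto simp: path_in_sphere_def path_image_def)
  moreover have "tau I z = tau (\<Theta>1 1) (\<gamma> 1)"
    using e assms by (simp add: circular_lift_def)
  ultimately consider "Im z = 0" "\<gamma> 1 = z" | "\<gamma> 1 = z" "\<Theta>1 1 = I" | "\<gamma> 1 = cnj z" "\<Theta>1 1 = - I"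
    using tau_eq_cases[OF assms(3)] by metis
  then show thesis
  proof cases
    case 3
    \<comment> \<open>The base ends at \<open>cnj z\<close>. Conjugating it and negating both
      spherical coordinates leaves the liftings pointwise unchanged.\<close>
    have "path_in_sphere (\<lambda>t. - \<Theta> t)" if "path_in_sphere \<Theta>" for \<Theta>
      using that by (simp add: path_in_sphere_def path_def path_image_def image_subset_iff
          uminus_oct_sphere continuous_on_minus)
    moreover have "path (\<lambda>t. cnj (\<gamma> t))"
      using *(1) by (auto simp: path_def intro: continuous_intros)
    moreover have "circular_lift (\<lambda>t. cnj (\<gamma> t)) (\<lambda>t. - \<Theta> t) = circular_lift \<gamma> \<Theta>" for \<Theta>
      by (simp add: fun_eq_iff circular_lift_def tau_cnj)
    ultimately show thesis
      using 3 * sub e(2)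
      by (intro that[of "\<lambda>t. cnj (\<gamma> t)" "\<lambda>t. - \<Theta>1 t" "\<lambda>t. - \<Theta>2 t"])
        (auto simp: tau_cnj circular_lift_def)
  next
    case 1
    then show thesis
      using * sub e(2) by (intro that[of \<gamma> \<Theta>1 \<Theta>2]) (auto simp: circular_lift_def)
  next
    case 2
    then show thesis
      using * sub e(2) by (intro that[of \<gamma> \<Theta>1 \<Theta>2]) (auto simp: circular_lift_def)
  qed
qed

text \<open>Freezes the spherical coordinate while the base runs through an appended
  segment.\<close>

lemma path_in_sphere_join_const:
  assumes "path_in_sphere \<Theta>"
  shows "path_in_sphere (\<Theta> +++ (\<lambda>_. \<Theta> 1))"
proof -
  have "path (\<lambda>_::real. \<Theta> 1)"
    by (simp add: path_def)
  then have "path (\<Theta> +++ (\<lambda>_. \<Theta> 1))"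
    using assms by (intro path_join_imp) (auto simp: path_in_sphere_def pathstart_def pathfinish_def)
  moreover have "path_image (\<Theta> +++ (\<lambda>_. \<Theta> 1)) \<subseteq> oct_sphere"
    using assms path_image_join_subset[of \<Theta> "\<lambda>_. \<Theta> 1"]
    by (fastforce simp: path_in_sphere_def path_image_def)
  ultimately show ?thesis
    by (simp add: path_in_sphere_def)
qed

lemma ccl_connected_near_real:
  assumes "open \<Omega>" "tau I z \<in> \<Omega>" "Im z = 0" "I \<in> oct_sphere" "J \<in> oct_sphere"
  shows "eventually (\<lambda>w. ccl_connected \<Omega> (tau I w) (tau J w)) (nhds z)"
proof -
  obtain r where r: "r > 0" "ball (tau I z) r \<subseteq> \<Omega>"
    using assms openE by blast
  obtain g where g: "path g" "path_image g \<subseteq> oct_sphere" "pathstart g = I" "pathfinish g = J"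
    using path_connected_oct_sphere assms unfolding path_connected_def by metis
  have "ccl_connected \<Omega> (tau I w) (tau J w)" if w: "w \<in> ball z r" for w
  proof -
    \<comment> \<open>As \<open>z\<close> is real, \<open>tau K z\<close> is the same point for
      every \<open>K\<close>, so one radius serves all slices; discs are convex and
      \<open>tau K\<close> is an isometry.\<close>
    have in_\<Omega>: "tau K v \<in> \<Omega>" if "K \<in> oct_sphere" "v \<in> closed_segment z w" for K v
    proof -
      have "v \<in> ball z r"
        using that w r by (meson closed_segment_subset convex_ball centre_in_ball subsetD)
      then have "tau K v \<in> ball (tau K z) r"
        using dist_tau[OF that(1)] by simp
      then show ?thesis
        using r tau_eq_real[OF assms(3)] by (metis subsetD)
    qed
    have seg: "linepath z w t \<in> closed_segment z w" if "t \<in> {0..1}" for t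
      using that by (metis imageI linepath_image_01)
    have g_in: "g t \<in> oct_sphere" if "t \<in> {0..1}" for t
      using g(2) that by (auto simp: path_image_def)
    show ?thesis
      unfolding ccl_connected_def
    proof (intro conjI exI)
      \<comment> \<open>The liftings over the segment via the constant \<open>I\<close> and via
        \<open>g\<close> are coupled because \<open>g\<close> starts at \<open>I\<close>.\<close>
      show "circular_lift (linepath z w) (\<lambda>_. I) ` {0..1} \<subseteq> \<Omega>"
        using in_\<Omega> seg assms(4) by (simp add: circular_lift_def image_subset_iff)
      show "circular_lift (linepath z w) g ` {0..1} \<subseteq> \<Omega>"
        using in_\<Omega> seg g_in by (simp add: circular_lift_def image_subset_iff)
      show "path_in_sphere (\<lambda>_. I)"
        using assms by (auto simp: path_in_sphere_def path_def path_image_def)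
      show "path_in_sphere g"
        using g by (simp add: path_in_sphere_def)
      show "tau I w \<in> \<Omega>" "tau J w \<in> \<Omega>"
        using in_\<Omega> assms by auto
    qed (use g in \<open>simp_all add: circular_lift_def pathstart_def pathfinish_def linepath_1'\<close>)
  qed
  then show ?thesis
    unfolding eventually_nhds using r(1) by (metis centre_in_ball open_ball)
qed

lemma circular_lift_join_linepath_in:
  assumes "circular_lift \<gamma> \<Theta> ` {0..1} \<subseteq> \<Omega>"
    and "closed_segment z w \<subseteq> slice \<Omega> (\<Theta> 1)"
  shows "circular_lift (\<gamma> +++ linepath z w) (\<Theta> +++ (\<lambda>_. \<Theta> 1)) ` {0..1} \<subseteq> \<Omega>"
proof -
  have "tau (\<Theta> 1) (linepath z w t) \<in> \<Omega>" if "t \<in> {0..1}" for t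
    using assms(2) that linepath_image_01[of z w] unfolding slice_def by blast
  then have "circular_lift (\<gamma> +++ linepath z w) (\<Theta> +++ (\<lambda>_. \<Theta> 1)) t \<in> \<Omega>" if "t \<in> {0..1}" for t
    using assms(1) that by (simp add: circular_lift_def joinpaths_def image_subset_iff)
  then show ?thesis
    by blast
qed

lemma ccl_connected_near:
  assumes "open \<Omega>" "ccl_connected \<Omega> (tau I z) (tau J z)" "I \<in> oct_sphere" "J \<in> oct_sphere"
  shows "eventually (\<lambda>w. ccl_connected \<Omega> (tau I w) (tau J w)) (nhds z)"
proof (cases "Im z = 0")
  case True
  moreover have "tau I z \<in> \<Omega>"
    using assms(2) by (simp add: ccl_connected_def)
  ultimately show ?thesis
    using assms by (intro ccl_connected_near_real)
next
  case False
  obtain \<gamma> \<Theta>1 \<Theta>2 where p: "path \<gamma>" and s: "path_in_sphere \<Theta>1" "path_in_sphere \<Theta>2"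
    and 0: "\<Theta>1 0 = \<Theta>2 0"
    and lift: "circular_lift \<gamma> \<Theta>1 ` {0..1} \<subseteq> \<Omega>" "circular_lift \<gamma> \<Theta>2 ` {0..1} \<subseteq> \<Omega>"
    and z: "\<gamma> 1 = z" and J': "tau J z = tau (\<Theta>2 1) z" and "Im z = 0 \<or> \<Theta>1 1 = I"
    by (rule ccl_connectedE[OF assms(2) refl assms(3)])
  then have I: "\<Theta>1 1 = I"
    using False by blast
  \<comment> \<open>Off the real axis, \<open>z\<close> and the lifted point determine the spherical
    coordinate.\<close>
  have J: "\<Theta>2 1 = J"
    using J' False by (simp add: tau_def)
  have "z \<in> slice \<Omega> I \<inter> slice \<Omega> J"
    using assms by (simp add: slice_def ccl_connected_def)
  then obtain r where r: "r > 0" "ball z r \<subseteq> slice \<Omega> I \<inter> slice \<Omega> J"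
    by (rule openE[OF open_Int[OF open_slice open_slice, OF assms(1) assms(1)]])
  have "ccl_connected \<Omega> (tau I w) (tau J w)" if w: "w \<in> ball z r" for w
  proof -
    have seg: "closed_segment z w \<subseteq> slice \<Omega> I \<inter> slice \<Omega> J"
      using w r by (meson closed_segment_subset convex_ball centre_in_ball subset_trans)
    have path: "path (\<gamma> +++ linepath z w)"
      using p z by (simp add: pathfinish_def)
    have "tau I w \<in> \<Omega>" "tau J w \<in> \<Omega>"
      using w r by (auto simp: slice_def)
    then show ?thesis
      unfolding ccl_connected_def
    proof (intro conjI exI)
      \<comment> \<open>Both extensions use the same base, and joining keeps the starting points, so
        the liftings stay coupled.\<close>
      show "circular_lift (\<gamma> +++ linepath z w) (\<Theta>1 +++ (\<lambda>_. \<Theta>1 1)) ` {0..1} \<subseteq> \<Omega>"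
        using seg I by (intro circular_lift_join_linepath_in lift) simp
      show "circular_lift (\<gamma> +++ linepath z w) (\<Theta>2 +++ (\<lambda>_. \<Theta>2 1)) ` {0..1} \<subseteq> \<Omega>"
        using seg J by (intro circular_lift_join_linepath_in lift) simp
      show "path (\<gamma> +++ linepath z w)"
        by (rule path)
      show "path_in_sphere (\<Theta>1 +++ (\<lambda>_. \<Theta>1 1))" "path_in_sphere (\<Theta>2 +++ (\<lambda>_. \<Theta>2 1))"
        using s by (simp_all add: path_in_sphere_join_const)
    qed (simp_all add: 0 I J circular_lift_def joinpaths_def linepath_1')
  qed
  then show ?thesis
    unfolding eventually_nhds using r(1) by (metis centre_in_ball open_ball)
qed

lemma ccl_connected_imp_ccl_equiv: "ccl_connected \<Omega> x y \<Longrightarrow> ccl_equiv \<Omega> x y"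
  unfolding ccl_equiv_def by (metis ccl_connected_def r_into_rtranclp)

text \<open>A chain has finitely many steps, so the neighbourhoods obtained for the single steps can
  be intersected.\<close>

lemma ccl_equiv_near:
  assumes "open \<Omega>" "ccl_equiv \<Omega> (tau I z) (tau J z)" "I \<in> oct_sphere" "J \<in> oct_sphere"
  shows "eventually (\<lambda>w. ccl_equiv \<Omega> (tau I w) (tau J w)) (nhds z)"
proof -
  have I_in: "tau I z \<in> \<Omega>"
    using assms by (simp add: ccl_equiv_def)
  have "eventually (\<lambda>w. ccl_equiv \<Omega> (tau I w) (tau J w)) (nhds z)"
    if "(ccl_connected \<Omega>)\<^sup>*\<^sup>* (tau I z) y" "y = tau J z" "J \<in> oct_sphere" for y J
    using that
  proof (induction arbitrary: J rule: rtranclp_induct)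
    \<comment> \<open>An empty chain gives only \<open>tau I z = tau J z\<close>. At real
      \<open>z\<close> the units may still differ, and nearby points then need a genuine CCL
      step.\<close>
    case base
    show ?case
    proof (cases "Im z = 0")
      case True
      then have "eventually (\<lambda>w. ccl_connected \<Omega> (tau I w) (tau J w)) (nhds z)"
        using ccl_connected_near_real I_in assms(1,3) base by blast
      then show ?thesis
        by eventually_elim (simp add: ccl_connected_imp_ccl_equiv)
    next
      case False
      then have "J = I"
        using base by (simp add: tau_def)
      have "eventually (\<lambda>w. w \<in> slice \<Omega> I) (nhds z)"
        using open_slice[OF assms(1)] I_in by (intro eventually_nhds_in_open) (auto simp: slice_def)
      then show ?thesis
        by eventually_elim (simp add: \<open>J = I\<close> ccl_equiv_def slice_def)
    qed
  next
    case (step y y')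
    \<comment> \<open>The step is reversed because \<open>ccl_connectedE\<close> normalises at its
      first point. This writes the intermediate point \<open>y\<close> over the same
      \<open>z\<close>, as the induction hypothesis requires.\<close>
    have "ccl_connected \<Omega> y' y"
      using step.hyps(2) unfolding ccl_connected_def by metis
    then obtain \<Theta> where "path_in_sphere \<Theta>" "y = tau (\<Theta> 1) z"
      using ccl_connectedE[OF _ step.prems] by metis
    moreover from this have "\<Theta> 1 \<in> oct_sphere"
      by (simp add: path_in_sphere_def path_image_def image_subset_iff)
    ultimately obtain K where K: "K \<in> oct_sphere" "y = tau K z"
      by blast
    have "eventually (\<lambda>w. ccl_equiv \<Omega> (tau I w) (tau K w)) (nhds z)"
      using step.IH K by blast
    moreover have "eventually (\<lambda>w. ccl_connected \<Omega> (tau K w) (tau J w)) (nhds z)"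
      using step K by (intro ccl_connected_near assms) auto
    ultimately show ?case
      unfolding ccl_equiv_def
      by eventually_elim (metis ccl_connected_def rtranclp.rtrancl_into_rtrancl)
  qed
  then show ?thesis
    using assms(2,4) by (simp add: ccl_equiv_def)
qed


section \<open>The slice projections are open embeddings\<close>

lemma topspace_D_space: "topspace (D_space \<Omega>) = (\<Union>I\<in>oct_sphere. pi_slice \<Omega> I ` slice \<Omega> I)"
  by (auto simp: D_space_def topspace_hat_space quotient_def pi_slice_def slice_def)

text \<open>Combines the quotient and disjoint-union topologies; since each slice is open in the
  plane, relative openness is plain openness.\<close>

lemma openin_D_space:
  assumes "open \<Omega>"
  shows "openin (D_space \<Omega>) V \<longleftrightarrow>
    V \<subseteq> topspace (D_space \<Omega>) \<and> (\<forall>J\<in>oct_sphere. open {w \<in> slice \<Omega> J. pi_slice \<Omega> J w \<in> V})"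
proof -
  let ?W = "{x \<in> topspace (hat_space \<Omega>). hat_rel \<Omega> `` {x} \<in> V}"
  have "openin (hat_space \<Omega>) ?W \<longleftrightarrow> (\<forall>J\<in>oct_sphere. open {w \<in> slice \<Omega> J. pi_slice \<Omega> J w \<in> V})"
  proof -
    have sub: "?W \<subseteq> Sigma oct_sphere (topspace \<circ> (\<lambda>J. top_of_set (slice \<Omega> J)))"
      by (auto simp: topspace_hat_space slice_def)
    have fibre: "{w. (J, w) \<in> ?W} = {w \<in> slice \<Omega> J. pi_slice \<Omega> J w \<in> V}" if "J \<in> oct_sphere" for J
      using that by (simp add: topspace_hat_space pi_slice_def slice_def)
    have "openin (top_of_set (slice \<Omega> J)) {w \<in> slice \<Omega> J. pi_slice \<Omega> J w \<in> V} \<longleftrightarrow>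
        open {w \<in> slice \<Omega> J. pi_slice \<Omega> J w \<in> V}" for J
      unfolding openin_open_eq[OF open_slice[OF assms]] by blast
    then show ?thesis
      using sub fibre by (subst hat_space_def) (simp only: openin_sum_topology simp_thms cong: ball_cong)
  qed
  then show ?thesis
    unfolding D_space_def openin_quotient_topology topspace_quotient_topology by simp
qed

lemma openin_pi_slice_image:
  assumes "open \<Omega>" "I \<in> oct_sphere" "open U" "U \<subseteq> slice \<Omega> I"
  shows "openin (D_space \<Omega>) (pi_slice \<Omega> I ` U)"
  unfolding openin_D_space[OF assms(1)]
proof (intro conjI ballI)
  show "pi_slice \<Omega> I ` U \<subseteq> topspace (D_space \<Omega>)"
    using assms by (auto simp: topspace_D_space)
next
  fix J assume J: "J \<in> oct_sphere"
  \<comment> \<open>Equal classes have equal complex coordinates, so the preimage in another slice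
    is \<open>U\<close> cut by the set where the two slices are glued; stability makes that set
    open.\<close>
  have eq: "{w \<in> slice \<Omega> J. pi_slice \<Omega> J w \<in> pi_slice \<Omega> I ` U} =
      U \<inter> {w. ccl_equiv \<Omega> (tau I w) (tau J w)}"
  proof (intro subset_antisym subsetI)
    fix w assume "w \<in> {w \<in> slice \<Omega> J. pi_slice \<Omega> J w \<in> pi_slice \<Omega> I ` U}"
    then obtain u where "u \<in> U" "w \<in> slice \<Omega> J" "pi_slice \<Omega> I u = pi_slice \<Omega> J w"
      by auto
    moreover from this have "u \<in> slice \<Omega> I"
      using assms(4) by blast
    ultimately show "w \<in> U \<inter> {w. ccl_equiv \<Omega> (tau I w) (tau J w)}"
      using assms(2) J by (auto simp: pi_slice_eq_iff)
  next
    fix w assume w: "w \<in> U \<inter> {w. ccl_equiv \<Omega> (tau I w) (tau J w)}"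
    then have "w \<in> slice \<Omega> I" "w \<in> slice \<Omega> J"
      by (auto simp: slice_def ccl_equiv_def)
    moreover from this have "pi_slice \<Omega> I w = pi_slice \<Omega> J w"
      using w assms(2) J by (simp add: pi_slice_eq_iff)
    moreover have "pi_slice \<Omega> I w \<in> pi_slice \<Omega> I ` U"
      using w by blast
    ultimately show "w \<in> {w \<in> slice \<Omega> J. pi_slice \<Omega> J w \<in> pi_slice \<Omega> I ` U}"
      by simp
  qed
  have "open {w. ccl_equiv \<Omega> (tau I w) (tau J w)}"
  proof (subst open_subopen, rule ballI)
    fix w assume "w \<in> {w. ccl_equiv \<Omega> (tau I w) (tau J w)}"
    then have "eventually (\<lambda>w. ccl_equiv \<Omega> (tau I w) (tau J w)) (nhds w)"
      by (intro ccl_equiv_near assms J) simp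
    then show "\<exists>T. open T \<and> w \<in> T \<and> T \<subseteq> {w. ccl_equiv \<Omega> (tau I w) (tau J w)}"
      unfolding eventually_nhds by blast
  qed
  then show "open {w \<in> slice \<Omega> J. pi_slice \<Omega> J w \<in> pi_slice \<Omega> I ` U}"
    unfolding eq using assms(3) by blast
qed

lemma homeomorphic_map_pi_slice:
  assumes "open \<Omega>" "I \<in> oct_sphere"
  shows "homeomorphic_map (top_of_set (slice \<Omega> I))
    (subtopology (D_space \<Omega>) (pi_slice \<Omega> I ` slice \<Omega> I)) (pi_slice \<Omega> I)"
proof (rule bijective_open_imp_homeomorphic_map)
  have sub: "pi_slice \<Omega> I ` slice \<Omega> I \<subseteq> topspace (D_space \<Omega>)"
    using assms by (auto simp: topspace_D_space)
  show "continuous_map (top_of_set (slice \<Omega> I))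
      (subtopology (D_space \<Omega>) (pi_slice \<Omega> I ` slice \<Omega> I)) (pi_slice \<Omega> I)"
  proof -
    have "continuous_map (top_of_set (slice \<Omega> I)) (D_space \<Omega>) (pi_slice \<Omega> I)"
      using assms sub open_slice[OF assms(1)]
      by (simp add: continuous_map_def openin_D_space openin_open_eq image_subset_iff_funcset)
    then show ?thesis
      by (simp add: continuous_map_in_subtopology)
  qed
  show "open_map (top_of_set (slice \<Omega> I))
      (subtopology (D_space \<Omega>) (pi_slice \<Omega> I ` slice \<Omega> I)) (pi_slice \<Omega> I)"
    using assms open_slice[OF assms(1)] openin_pi_slice_image[OF assms]
    by (auto simp: open_map_def openin_open_eq openin_open_subtopology)
  show "pi_slice \<Omega> I ` topspace (top_of_set (slice \<Omega> I)) =
      topspace (subtopology (D_space \<Omega>) (pi_slice \<Omega> I ` slice \<Omega> I))"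
    using sub by auto
  show "inj_on (pi_slice \<Omega> I) (topspace (top_of_set (slice \<Omega> I)))"
    using inj_on_pi_slice[OF assms(2)] by simp
qed

text \<open>Here \<open>P_map\<close> agrees with the inverse of the homeomorphism
  \<open>pi_slice \<Omega> I\<close>.\<close>

lemma homeomorphic_map_P_map:
  assumes "open \<Omega>" "I \<in> oct_sphere"
  shows "homeomorphic_map (subtopology (D_space \<Omega>) (pi_slice \<Omega> I ` slice \<Omega> I))
    (top_of_set (slice \<Omega> I)) (P_map \<Omega>)"
proof -
  obtain g where g: "homeomorphic_maps (top_of_set (slice \<Omega> I))
      (subtopology (D_space \<Omega>) (pi_slice \<Omega> I ` slice \<Omega> I)) (pi_slice \<Omega> I) g"
    using homeomorphic_map_pi_slice[OF assms] unfolding homeomorphic_map_maps by blast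
  then have "homeomorphic_map (subtopology (D_space \<Omega>) (pi_slice \<Omega> I ` slice \<Omega> I))
      (top_of_set (slice \<Omega> I)) g"
    using homeomorphic_maps_map by blast
  moreover have "g c = P_map \<Omega> c"
    if "c \<in> topspace (subtopology (D_space \<Omega>) (pi_slice \<Omega> I ` slice \<Omega> I))" for c
    using that g P_map_pi_slice[OF assms(2)] by (auto simp: homeomorphic_maps_def)
  ultimately show ?thesis
    using homeomorphic_map_eq by blast
qed

lemma P_map_image: "I \<in> oct_sphere \<Longrightarrow> P_map \<Omega> ` pi_slice \<Omega> I ` slice \<Omega> I = slice \<Omega> I"
  by (force simp: P_map_pi_slice image_iff)

section \<open>Riemann domain property and holomorphy of \<open>P_map\<close>\<close>

lemma riemann_domain_D_space:
  assumes "open \<Omega>"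
  shows "riemann_domain (D_space \<Omega>) (P_map \<Omega>)"
  unfolding riemann_domain_def local_homeomorphism_def
proof
  fix c assume "c \<in> topspace (D_space \<Omega>)"
  then obtain I where "I \<in> oct_sphere" "c \<in> pi_slice \<Omega> I ` slice \<Omega> I"
    by (auto simp: topspace_D_space)
  then show "\<exists>U. c \<in> U \<and> openin (D_space \<Omega>) U \<and> openin euclidean (P_map \<Omega> ` U) \<and>
      homeomorphic_map (subtopology (D_space \<Omega>) U) (top_of_set (P_map \<Omega> ` U)) (P_map \<Omega>)"
    using assms
    by (intro exI[of _ "pi_slice \<Omega> I ` slice \<Omega> I"])
      (simp add: P_map_image open_slice openin_pi_slice_image homeomorphic_map_P_map)
qed

text \<open>On each slice image \<open>P_map\<close> is the atlas chart, so in any chart of the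
  structure it reads locally as a transition map, holomorphic by compatibility.\<close>

lemma holomorphic_wrt_P_map:
  assumes "open \<Omega>"
  shows "holomorphic_wrt (Pi_structure \<Omega>) (P_map \<Omega>)"
  unfolding holomorphic_wrt_def
proof safe
  fix U :: "(octonion \<times> complex) set set" and \<phi>
  assume "(U, \<phi>) \<in> Pi_structure \<Omega>"
  then have chart: "openin (D_space \<Omega>) U" "open (\<phi> ` U)"
      "homeomorphic_map (subtopology (D_space \<Omega>) U) (top_of_set (\<phi> ` U)) \<phi>"
    and comp: "\<And>a. a \<in> slice_atlas \<Omega> \<Longrightarrow> compatible_charts a (U, \<phi>)"
    by (auto simp: Pi_structure_def generated_complex_structure_def complex_chart_def)
  let ?V = "\<lambda>I. pi_slice \<Omega> I ` slice \<Omega> I"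
  have "(P_map \<Omega> \<circ> inv_into U \<phi>) holomorphic_on \<phi> ` (?V I \<inter> U)" if I: "I \<in> oct_sphere" for I
  proof -
    have "(inv_into (slice \<Omega> I) (pi_slice \<Omega> I) \<circ> inv_into U \<phi>) holomorphic_on \<phi> ` (?V I \<inter> U)"
      using comp I by (fastforce simp: slice_atlas_def compatible_charts_def)
    moreover have "inv_into (slice \<Omega> I) (pi_slice \<Omega> I) (inv_into U \<phi> p) = P_map \<Omega> (inv_into U \<phi> p)"
      if "p \<in> \<phi> ` (?V I \<inter> U)" for p
    proof -
      \<comment> \<open>Injectivity makes \<open>inv_into U \<phi>\<close> return the original
        point, which lies in the slice image.\<close>
      have "inj_on \<phi> U"
        using chart homeomorphic_imp_injective_map openin_subset
        by (metis topspace_subtopology_subset)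
      then have "inv_into U \<phi> p \<in> ?V I"
        using that by auto
      then show ?thesis
        using I by (auto simp: P_map_pi_slice inj_on_pi_slice)
    qed
    ultimately show ?thesis
      by (elim holomorphic_transform) simp
  qed
  \<comment> \<open>Gluing holomorphy over the pieces requires them to be open; this is where
    openness of the slice projections enters.\<close>
  moreover have "open (\<phi> ` (?V I \<inter> U))" if I: "I \<in> oct_sphere" for I
  proof -
    have "openin (D_space \<Omega>) (?V I)"
      using openin_pi_slice_image assms I open_slice by blast
    then have "openin (subtopology (D_space \<Omega>) U) (?V I \<inter> U)"
      by (rule openin_subtopology_Int)
    then have "openin (top_of_set (\<phi> ` U)) (\<phi> ` (?V I \<inter> U))"
      using chart(3) by (meson homeomorphic_imp_open_map open_map_def)
    then show ?thesis
      using chart(2) by (simp add: openin_open_eq)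
  qed
  ultimately have "(P_map \<Omega> \<circ> inv_into U \<phi>) holomorphic_on (\<Union>I\<in>oct_sphere. \<phi> ` (?V I \<inter> U))"
    by (intro holomorphic_on_UN_open) auto
  moreover have "(\<Union>I\<in>oct_sphere. \<phi> ` (?V I \<inter> U)) = \<phi> ` U"
    using openin_subset[OF chart(1)] unfolding topspace_D_space by blast
  ultimately show "(P_map \<Omega> \<circ> inv_into U \<phi>) holomorphic_on \<phi> ` U"
    by simp
qed

theorem theorem5p7:
  fixes \<Omega> :: "octonion set"
  assumes "open \<Omega>" and "connected \<Omega>" and "\<Omega> \<noteq> {}"
  shows "holomorphic_wrt (Pi_structure \<Omega>) (P_map \<Omega>) \<and>
         riemann_domain (D_space \<Omega>) (P_map \<Omega>)"
  using holomorphic_wrt_P_map riemann_domain_D_space assms(1) by blast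

end
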